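(* Let $\alpha,\beta\in\mathbb{C}$ be algebraic integers such that the number fields $\mathbb{Q}(\alpha)$ and $\mathbb{Q}(\beta)$ are linearly disjoint, and let $f,g\in\mathbb{Z}[x]$ be the minimal polynomials over $\mathbb{Q}$ of $\alpha$ and $\beta$ respectively. Let $(t,p)$ be a first-degree prime ideal of $\mathbb{Z}[\alpha+\beta]$ such that $t$ is a simple root of $R_{f,g} \bmod p$. Then $(t,p)$ is a combination of first-degree prime ideals of $\mathbb{Z}[\alpha]$ and $\mathbb{Z}[\beta]$, i.e. there exist a first-degree prime ideal $(r,p)$ of $\mathbb{Z}[\alpha]$ and a first-degree prime ideal $(s,p)$ of $\mathbb{Z}[\beta]$ with $t=r+s$ in $\mathbb{F}_p$.
   Context: Two number fields $L_1,L_2\subset\mathbb{C}$ are linearly disjoint if the natural $\mathbb{Q}$-algebra homomorphism $L_1\otimes_{\mathbb{Q}}L_2\to L_1L_2$, $a\otimes b\mapsto ab$, is injective; equivalently $[L_1L_2:\mathbb{Q}]=[L_1:\mathbb{Q}][L_2:\mathbb{Q}]$. For polynomials $f,g$, the polynomial $R_{f,g}$ is defined by $R_{f,g}(y)=R\big(f(x),g(y-x)\big)$, where $R(\cdot,\cdot)$ is the resultant (determinant of the Sylvester matrix) with respect to $x$; it is regarded as a polynomial in one variable. For $\mathbb{Q}(\alpha),\mathbb{Q}(\beta)$ linearly disjoint, $R_{f,g}$ is the minimal polynomial of $\alpha+\beta$ over $\mathbb{Q}$. For an algebraic integer $\theta$, a first-degree prime ideal of $\mathbb{Z}[\theta]$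 is a non-zero prime ideal $\mathfrak{p}$ of $\mathbb{Z}[\theta]$ whose norm $[\mathbb{Z}[\theta]:\mathfrak{p}]$ is a prime number. If $h\in\mathbb{Z}[x]$ is the (monic) minimal polynomial of $\theta$ over $\mathbb{Q}$, the first-degree prime ideals of $\mathbb{Z}[\theta]$ of norm $p$ are in bijection with the pairs $(t,p)$ with $t\in\mathbb{F}_p$ and $h(t)=0$ in $\mathbb{F}_p$; the pair $(t,p)$ denotes the kernel of the ring homomorphism $\mathbb{Z}[\theta]\to\mathbb{F}_p$, $\theta\mapsto t$. The combination of the first-degree prime ideals $(r,p)\subseteq\mathbb{Z}[\alpha]$ and $(s,p)\subseteq\mathbb{Z}[\beta]$ is the first-degree prime ideal $(r+s,p)\subseteq\mathbb{Z}[\alpha+\beta]$. *)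

theory Defs
  imports
    "HOL-Computational_Algebra.Computational_Algebra"
    "HOL-Library.Poly_Mapping"
    "HOL-Algebra.Generated_Rings"
    "HOL-Algebra.Generated_Fields"
    "HOL-Algebra.QuotRing"
    "HOL-Algebra.Algebraic_Closure_Type"
    "Subresultants.Resultant_Prelim"
    "Berlekamp_Zassenhaus.Finite_Field"
begin

abbreviation complex_ring :: "complex ring" where
  "complex_ring \<equiv> ring_of_type_algebra"

text \<open>
  The prime field with \<open>p\<close> elements is the type \<^typ>\<open>'p mod_ring\<close> for a type \<^typ>\<open>'p\<close> of class
  \<^class>\<open>prime_card\<close>, so that \<open>p = CARD('p)\<close>.
\<close>

abbreviation prime_field_ring :: "'p :: prime_card mod_ring ring" where
  "prime_field_ring \<equiv> ring_of_type_algebra"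

text \<open>
  \<open>\<int>[\<theta>]\<close> as a ring and \<open>\<rat>(\<theta>)\<close> as a set. The latter is the subfield of the complex numbers
  generated by \<open>\<theta>\<close>; it contains the rationals because the characteristic is 0.
\<close>

definition int_adjoin :: "complex \<Rightarrow> complex ring" where
  "int_adjoin \<theta> = complex_ring \<lparr>carrier := generate_ring complex_ring {\<theta>}\<rparr>"

definition rat_adjoin :: "complex \<Rightarrow> complex set" where
  "rat_adjoin \<theta> = generate_field complex_ring {\<theta>}"

section \<open>Linear disjointness\<close>

text \<open>
  The tensor product \<open>K \<otimes>\<^sub>\<rat> L\<close> is the quotient of the free rational vector space on \<open>K \<times> L\<close>
  by the span of the bilinearity relations. An element of the free space is a finitely
  supported function, \<^term>\<open>Poly_Mapping.single (a, b) q\<close> being \<open>q\<close> times the basis vector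
  at \<open>(a, b)\<close>.
\<close>

definition free_on_pairs :: "complex set \<Rightarrow> complex set \<Rightarrow> (complex \<times> complex \<Rightarrow>\<^sub>0 rat) set" where
  "free_on_pairs K L = {z. Poly_Mapping.keys z \<subseteq> K \<times> L}"

text \<open>
  Every generator carries an arbitrary rational coefficient \<open>q\<close>, so closure under addition
  already yields the rational span.
\<close>

inductive_set tensor_relations :: "complex set \<Rightarrow> complex set \<Rightarrow> (complex \<times> complex \<Rightarrow>\<^sub>0 rat) set"
  for K L where
  zero: "0 \<in> tensor_relations K L"
| add_left: "a \<in> K \<Longrightarrow> a' \<in> K \<Longrightarrow> b \<in> L \<Longrightarrow>
    Poly_Mapping.single (a + a', b) q - Poly_Mapping.single (a, b) q - Poly_Mapping.single (a', b) q
      \<in> tensor_relations K L"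
| add_right: "a \<in> K \<Longrightarrow> b \<in> L \<Longrightarrow> b' \<in> L \<Longrightarrow>
    Poly_Mapping.single (a, b + b') q - Poly_Mapping.single (a, b) q - Poly_Mapping.single (a, b') q
      \<in> tensor_relations K L"
| scale_left: "a \<in> K \<Longrightarrow> b \<in> L \<Longrightarrow>
    Poly_Mapping.single (of_rat c * a, b) q - Poly_Mapping.single (a, b) (c * q)
      \<in> tensor_relations K L"
| scale_right: "a \<in> K \<Longrightarrow> b \<in> L \<Longrightarrow>
    Poly_Mapping.single (a, of_rat c * b) q - Poly_Mapping.single (a, b) (c * q)
      \<in> tensor_relations K L"
| sum: "x \<in> tensor_relations K L \<Longrightarrow> y \<in> tensor_relations K L \<Longrightarrow> x + y \<in> tensor_relations K L"

definition tensor_equiv ::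
  "complex set \<Rightarrow> complex set \<Rightarrow> ((complex \<times> complex \<Rightarrow>\<^sub>0 rat) \<times> (complex \<times> complex \<Rightarrow>\<^sub>0 rat)) set" where
  "tensor_equiv K L =
     {(x, y). x \<in> free_on_pairs K L \<and> y \<in> free_on_pairs K L \<and> x - y \<in> tensor_relations K L}"

definition tensor_product ::
  "complex set \<Rightarrow> complex set \<Rightarrow> (complex \<times> complex \<Rightarrow>\<^sub>0 rat) set set" where
  "tensor_product K L = free_on_pairs K L // tensor_equiv K L"

definition free_mult :: "(complex \<times> complex \<Rightarrow>\<^sub>0 rat) \<Rightarrow> complex" where
  "free_mult z = (\<Sum>(a, b) \<in> Poly_Mapping.keys z. of_rat (Poly_Mapping.lookup z (a, b)) * (a * b))"

text \<open>
  The map \<open>a \<otimes> b \<mapsto> ab\<close> on classes: by \<open>tensor_mult_class\<close> below, \<^const>\<open>free_mult\<close> is constant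
  on each class.
\<close>

definition tensor_mult :: "(complex \<times> complex \<Rightarrow>\<^sub>0 rat) set \<Rightarrow> complex" where
  "tensor_mult c = the_elem (free_mult ` c)"

definition linearly_disjoint :: "complex set \<Rightarrow> complex set \<Rightarrow> bool" where
  "linearly_disjoint K L \<longleftrightarrow> inj_on tensor_mult (tensor_product K L)"

lemma free_mult_superset:
  assumes "finite A" "Poly_Mapping.keys z \<subseteq> A"
  shows "free_mult z = (\<Sum>(a, b) \<in> A. of_rat (Poly_Mapping.lookup z (a, b)) * (a * b))"
  unfolding free_mult_def using assms
  by (intro sum.mono_neutral_left) (auto simp: in_keys_iff)

lemma free_mult_add: "free_mult (x + y) = free_mult x + free_mult y"
proof -
  let ?A = "Poly_Mapping.keys x \<union> Poly_Mapping.keys y"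
  have "Poly_Mapping.keys (x + y) \<subseteq> ?A" by (rule Poly_Mapping.keys_add)
  then show ?thesis
    by (simp add: free_mult_superset[of ?A] lookup_add of_rat_add ring_distribs
        sum.distrib[symmetric] case_prod_unfold)
qed

lemma free_mult_uminus: "free_mult (- x) = - free_mult x"
  using free_mult_add[of x "- x"] by (simp add: free_mult_def add_eq_0_iff)

lemma free_mult_diff: "free_mult (x - y) = free_mult x - free_mult y"
  using free_mult_add[of x "- y"] by (simp add: free_mult_uminus)

lemma free_mult_single: "free_mult (Poly_Mapping.single (a, b) q) = of_rat q * (a * b)"
  by (simp add: free_mult_superset[of "{(a, b)}"])

lemma free_mult_relations: "z \<in> tensor_relations K L \<Longrightarrow> free_mult z = 0"
  by (induction rule: tensor_relations.induct)
     (auto simp: free_mult_add free_mult_diff free_mult_single of_rat_mult algebra_simps,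
      simp add: free_mult_def)

lemma uminus_tensor_relations: "z \<in> tensor_relations K L \<Longrightarrow> - z \<in> tensor_relations K L"
proof (induction rule: tensor_relations.induct)
  case zero
  then show ?case by (simp add: tensor_relations.zero)
next
  case (add_left a a' b q)
  from tensor_relations.add_left[OF this, of "- q"] show ?case
    by (simp add: single_uminus algebra_simps)
next
  case (add_right a b b' q)
  from tensor_relations.add_right[OF this, of "- q"] show ?case
    by (simp add: single_uminus algebra_simps)
next
  case (scale_left a b c q)
  from tensor_relations.scale_left[OF this, of c "- q"] show ?case
    by (simp add: single_uminus algebra_simps)
next
  case (scale_right a b c q)
  from tensor_relations.scale_right[OF this, of c "- q"] show ?case
    by (simp add: single_uminus algebra_simps)
next
  case (sum x y)
  from tensor_relations.sum[OF sum.IH] show ?case by simp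
qed

lemma equiv_tensor_equiv: "equiv (free_on_pairs K L) (tensor_equiv K L)"
proof (rule equivI)
  show "tensor_equiv K L \<subseteq> free_on_pairs K L \<times> free_on_pairs K L"
    by (auto simp: tensor_equiv_def)
  show "refl_on (free_on_pairs K L) (tensor_equiv K L)"
    by (auto simp: refl_on_def tensor_equiv_def tensor_relations.zero)
  show "sym (tensor_equiv K L)"
    by (auto simp: sym_def tensor_equiv_def dest: uminus_tensor_relations)
  show "trans (tensor_equiv K L)"
    by (auto simp: trans_def tensor_equiv_def dest: tensor_relations.sum)
qed

lemma tensor_mult_class:
  assumes "z \<in> free_on_pairs K L"
  shows "tensor_mult (tensor_equiv K L `` {z}) = free_mult z"
proof -
  have "free_mult y = free_mult z" if "(z, y) \<in> tensor_equiv K L" for y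
    using that free_mult_relations[of "z - y" K L] by (simp add: tensor_equiv_def free_mult_diff)
  moreover have "(z, z) \<in> tensor_equiv K L"
    using assms equiv_tensor_equiv by (metis equiv_class_self Image_singleton_iff)
  ultimately have "free_mult ` (tensor_equiv K L `` {z}) = {free_mult z}"
    by blast
  then show ?thesis by (simp add: tensor_mult_def)
qed

section \<open>Minimal polynomials and the resultant\<close>

definition is_min_poly_rat :: "rat poly \<Rightarrow> complex \<Rightarrow> bool" where
  "is_min_poly_rat f \<theta> \<longleftrightarrow>
     Polynomial.coeff f (Polynomial.degree f) = 1 \<and>
     poly (map_poly of_rat f) \<theta> = 0 \<and>
     (\<forall>h. h \<noteq> 0 \<longrightarrow> poly (map_poly of_rat h) \<theta> = 0 \<longrightarrow> Polynomial.degree f \<le> Polynomial.degree h)"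

text \<open>
  In \<^typ>\<open>int poly poly\<close> the inner variable is \<open>y\<close> and the outer one is \<open>x\<close>, the variable
  with respect to which the resultant is taken. The inner polynomial is \<open>[:[:0, 1:], -1:] = y - x\<close>.
\<close>

definition sum_resultant :: "int poly \<Rightarrow> int poly \<Rightarrow> int poly" where
  "sum_resultant f g =
     resultant (map_poly (\<lambda>c. [:c:]) f) (pcompose (map_poly (\<lambda>c. [:c:]) g) [:[:0, 1:], -1:])"

definition is_simple_root :: "'a :: idom poly \<Rightarrow> 'a \<Rightarrow> bool" where
  "is_simple_root q t \<longleftrightarrow> q \<noteq> 0 \<and> Polynomial.order t q = 1"

section \<open>First-degree prime ideals\<close>

definition first_degree_prime :: "complex \<Rightarrow> complex set \<Rightarrow> bool" where
  "first_degree_prime \<theta> P \<longleftrightarrow>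
     primeideal P (int_adjoin \<theta>) \<and> P \<noteq> {0} \<and>
     Factorial_Ring.prime (card (carrier (int_adjoin \<theta> Quot P)))"

text \<open>
  \<open>P\<close> is the ideal denoted by the pair \<open>(t, p)\<close>: the kernel of the ring homomorphism from
  \<open>\<int>[\<theta>]\<close> to the field with \<open>p\<close> elements sending \<open>\<theta>\<close> to \<open>t\<close>. There is at most one such
  homomorphism, and hence at most one such \<open>P\<close>.
\<close>

definition pair_ideal :: "complex \<Rightarrow> 'p :: prime_card mod_ring \<Rightarrow> complex set \<Rightarrow> bool" where
  "pair_ideal \<theta> t P \<longleftrightarrow>
     (\<exists>\<phi> \<in> Ring.ring_hom (int_adjoin \<theta>) prime_field_ring.
        \<phi> \<theta> = t \<and> P = a_kernel (int_adjoin \<theta>) prime_field_ring \<phi>)"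

definition first_degree_prime_pair :: "complex \<Rightarrow> 'p :: prime_card mod_ring \<Rightarrow> bool" where
  "first_degree_prime_pair \<theta> t \<longleftrightarrow> (\<exists>P. pair_ideal \<theta> t P \<and> first_degree_prime \<theta> P)"

end

theory Submission
  imports Defs "Subresultants.Subresultant_Gcd"
begin

text \<open>
  Let \<open>F\<close>, \<open>G\<close> be the reductions of \<open>f\<close>, \<open>g\<close> modulo \<open>p\<close> and \<open>D = gcd(F(x), G(t - x))\<close>. Since \<open>t\<close> is a
  root of the resultant, \<open>D\<close> is not constant, and \<open>(y - t)\<close> to the power \<open>deg D\<close> divides the
  resultant, because modulo \<open>y - t\<close> the rows of the Sylvester matrix are multiples of \<open>D\<close>. As \<open>t\<close>
  is a simple root, \<open>D\<close> is linear, so its root \<open>r\<close> lies in the prime field itself, \<open>F(r) = 0\<close> and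
  \<open>G(t - r) = 0\<close>. Roots of \<open>f\<close> modulo \<open>p\<close> give homomorphisms from \<open>\<int>[\<alpha>]\<close> to the prime field, because
  \<open>f\<close> is monic and so divides in \<open>\<int>[x]\<close> every integer polynomial vanishing at \<open>\<alpha>\<close>.
\<close>

section \<open>Common factors at \<open>y = t\<close> and powers of \<open>y - t\<close> in the
  resultant\<close>

lemma mod_poly_sum: "(\<Sum>i\<in>A. f i) mod D = (\<Sum>i\<in>A. f i mod D)" for D :: "'a :: field poly"
  by (induction A rule: infinite_finite_induct) (auto simp: poly_mod_add_left)

text \<open>Reduction modulo \<open>D\<close> is linear, so it is determined by the remainders of
  the monomials. These remainders supply the column operations on the Sylvester matrix
  below.\<close>

lemma coeff_mod_eq_sum:
  fixes D p :: "'a :: field poly"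
  assumes "Polynomial.degree p < N"
  shows "Polynomial.coeff (p mod D) e =
     (\<Sum>l<N. Polynomial.coeff p l * Polynomial.coeff (Polynomial.monom 1 l mod D) e)"
proof -
  have "p = (\<Sum>l<N. smult (Polynomial.coeff p l) (Polynomial.monom 1 l))"
    using assms by (intro poly_eqI)
      (auto simp: coeff_sum if_distrib[of "\<lambda>x. _ * x"] coeff_eq_0 cong: if_cong)
  then have "p mod D = (\<Sum>l<N. smult (Polynomial.coeff p l) (Polynomial.monom 1 l mod D))"
    by (metis (no_types, lifting) mod_smult_left mod_poly_sum sum.cong)
  then show ?thesis by (simp add: coeff_sum)
qed

text \<open>One factor \<open>c\<close> can be pulled out of each of the last \<open>d\<close>
  columns: \<open>A = N * E\<close> with \<open>E\<close> diagonal of determinant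
  \<open>c ^ d\<close>.\<close>

lemma det_dvd_if_last_cols_dvd:
  fixes A :: "'a :: comm_ring_1 mat"
  assumes A: "A \<in> carrier_mat n n" and "d \<le> n"
    and dvd: "\<And>i j. i < n \<Longrightarrow> n - d \<le> j \<Longrightarrow> j < n \<Longrightarrow> c dvd A $$ (i, j)"
  shows "c ^ d dvd det A"
proof -
  \<comment> \<open>The ring has no division operation, so a quotient is chosen for each entry; only
    entries in the last \<open>d\<close> columns are used.\<close>
  define q where "q i j = (SOME x. A $$ (i, j) = c * x)" for i j
  have q: "A $$ (i, j) = c * q i j" if "i < n" "n - d \<le> j" "j < n" for i j
    unfolding q_def by (rule someI_ex) (use dvd[OF that] in \<open>auto elim: dvdE\<close>)
  define N where "N = mat n n (\<lambda>(i, j). if j < n - d then A $$ (i, j) else q i j)"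
  define E where "E = mat n n (\<lambda>(i, j). if i = j then (if j < n - d then 1 else c) else 0)"
  have E: "E \<in> carrier_mat n n" and N: "N \<in> carrier_mat n n"
    by (auto simp: E_def N_def)
  have "A = N * E"
  proof (rule eq_matI)
    fix i j assume "i < dim_row (N * E)" "j < dim_col (N * E)"
    then have ij: "i < n" "j < n" by (auto simp: E_def N_def)
    then have "(N * E) $$ (i, j) = (\<Sum>k<n. N $$ (i, k) * E $$ (k, j))"
      using E N by (auto simp: times_mat_def scalar_prod_def atLeast0LessThan)
    also have "\<dots> = (\<Sum>k<n. if k = j then N $$ (i, j) * E $$ (j, j) else 0)"
      using ij by (intro sum.cong) (auto simp: E_def)
    also have "\<dots> = N $$ (i, j) * E $$ (j, j)" using ij by simp
    also have "\<dots> = A $$ (i, j)"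
      using ij q[of i j] by (auto simp: N_def E_def mult.commute)
    finally show "A $$ (i, j) = (N * E) $$ (i, j)" by simp
  qed (use A in \<open>auto simp: E_def N_def\<close>)
  then have "det A = det N * det E" using det_mult[OF N E] by simp
  moreover have "det E = prod_list (diag_mat E)"
    by (rule det_upper_triangular[OF _ E]) (auto simp: E_def)
  moreover have "prod_list (diag_mat E) = (\<Prod>j<n. if j < n - d then 1 else c)"
    by (auto simp: diag_mat_def E_def prod.list_conv_set_nth atLeast0LessThan intro!: prod.cong)
  moreover have "\<dots> = (\<Prod>j\<in>{n - d..<n}. c)"
    by (rule prod.mono_neutral_cong_right) auto
  ultimately show ?thesis using \<open>d \<le> n\<close> by simp
qed

text \<open>Column operations of determinant 1 make the last \<open>degree D\<close> columns vanish
  at \<open>y = t\<close>, and each of them then contributes a factor \<open>y - t\<close>. The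
  bound \<open>le\<close> guarantees that the matrix has that many columns.\<close>

lemma resultant_dvd_if_common_factor:
  fixes F G :: "'a :: field poly poly" and D :: "'a poly"
  assumes F: "D dvd map_poly (\<lambda>c. poly c t) F" and G: "D dvd map_poly (\<lambda>c. poly c t) G"
    and le: "Polynomial.degree D \<le> Polynomial.degree F + Polynomial.degree G"
  shows "[:-t, 1:] ^ Polynomial.degree D dvd resultant F G"
proof -
  define m n N d where "m = Polynomial.degree F" and "n = Polynomial.degree G"
    and "N = m + n" and "d = Polynomial.degree D"
  interpret ev: map_poly_comm_ring_hom "\<lambda>c :: 'a poly. poly c t" ..
  define S where "S = sylvester_mat F G"
  \<comment> \<open>Row \<open>i\<close> of the Sylvester matrix lists the coefficients of
    \<open>P i\<close> from degree \<open>N - 1\<close> downwards, so column \<open>j\<close>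
    belongs to degree \<open>N - 1 - j\<close>.\<close>
  define P where "P i = (if i < n then Polynomial.monom 1 (n - 1 - i) * F
                          else Polynomial.monom 1 (N - 1 - i) * G)" for i
  have S: "S \<in> carrier_mat N N" by (auto simp: S_def N_def m_def n_def intro: sylvester_carrier_mat)
  have S_P: "S $$ (i, j) = Polynomial.coeff (P i) (N - 1 - j)" if "i < N" "j < N" for i j
    using that unfolding S_def
    by (subst sylvester_index_mat)
       (auto simp: P_def N_def m_def[symmetric] n_def[symmetric] coeff_monom_mult not_le
         intro!: arg_cong[of _ _ "Polynomial.coeff _"] coeff_eq_0)
  have P_deg: "Polynomial.degree (P i) < N" if "i < N" for i
    using that
      degree_mult_le[of "Polynomial.monom 1 (n - 1 - i)" F] degree_mult_le[of "Polynomial.monom 1 (N - 1 - i)" G]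
      degree_monom_le[of "1 :: 'a poly" "n - 1 - i"] degree_monom_le[of "1 :: 'a poly" "N - 1 - i"]
    by (auto simp: P_def N_def m_def[symmetric] n_def[symmetric])
  have P_dvd: "D dvd map_poly (\<lambda>c. poly c t) (P i)" for i
    using F G by (auto simp: P_def ev.hom_mult)
  \<comment> \<open>Right multiplication by \<open>U\<close> adds multiples of the other columns to the last \<open>d\<close> ones, which
    then hold the coefficients of the row polynomials reduced modulo \<open>D\<close>.\<close>
  define U where "U = mat N N (\<lambda>(i, j). if j < N - d then (if i = j then 1 else 0)
       else [:Polynomial.coeff (Polynomial.monom 1 (N - 1 - i) mod D) (N - 1 - j):])"
  have U: "U \<in> carrier_mat N N" by (simp add: U_def)
  \<comment> \<open>Monomials of degree below \<open>d\<close> are their own remainders. Hence the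
    lower right block of \<open>U\<close>, of size \<open>d\<close>, is the identity and
    \<open>U\<close> is unitriangular.\<close>
  have small: "Polynomial.monom 1 l mod D = Polynomial.monom 1 l" if "l < d" for l
    using that by (intro mod_poly_less) (simp add: d_def degree_monom_eq)
  have "upper_triangular U"
    by (auto simp: U_def small)
  then have "det U = prod_list (diag_mat U)" using det_upper_triangular U by blast
  also have "\<dots> = (\<Prod>j<N. U $$ (j, j))"
    by (simp add: diag_mat_def prod.list_conv_set_nth U_def atLeast0LessThan)
  also have "\<dots> = 1" by (intro prod.neutral) (auto simp: U_def small pCons_one)
  finally have det_U: "det U = 1" .
  have "[:-t, 1:] ^ d dvd det (S * U)"
  proof (rule det_dvd_if_last_cols_dvd)
    fix i j assume ij: "i < N" "N - d \<le> j" "j < N"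
    have "(S * U) $$ (i, j) = (\<Sum>k<N. S $$ (i, k) * U $$ (k, j))"
      using ij S U by (auto simp: times_mat_def scalar_prod_def atLeast0LessThan)
    also have "\<dots> = (\<Sum>k<N. Polynomial.coeff (P i) (N - 1 - k) *
        [:Polynomial.coeff (Polynomial.monom 1 (N - 1 - k) mod D) (N - 1 - j):])"
      using ij by (intro sum.cong) (auto simp: S_P U_def)
    also have "\<dots> = (\<Sum>l<N. Polynomial.coeff (P i) l *
        [:Polynomial.coeff (Polynomial.monom 1 l mod D) (N - 1 - j):])"
      by (rule sum.reindex_bij_witness[of _ "\<lambda>k. N - 1 - k" "\<lambda>k. N - 1 - k"]) auto
    finally have "poly ((S * U) $$ (i, j)) t = (\<Sum>l<N. Polynomial.coeff (map_poly (\<lambda>c. poly c t) (P i)) l *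
        Polynomial.coeff (Polynomial.monom 1 l mod D) (N - 1 - j))"
      by (simp add: poly_sum mult.commute)
    also have "\<dots> = Polynomial.coeff (map_poly (\<lambda>c. poly c t) (P i) mod D) (N - 1 - j)"
      using P_deg[OF ij(1)] by (intro coeff_mod_eq_sum[symmetric]) (rule le_less_trans[OF degree_map_poly_le])
    also have "\<dots> = 0" using P_dvd by (simp add: mod_eq_0_iff_dvd[THEN iffD2])
    finally show "[:-t, 1:] dvd (S * U) $$ (i, j)" by (simp add: poly_eq_0_iff_dvd)
  qed (use S U le in \<open>auto simp: d_def N_def m_def n_def\<close>)
  then show ?thesis
    using det_mult[OF S U] det_U by (simp add: S_def resultant_def d_def)
qed

section \<open>Reduction of the resultant modulo p and its value at \<open>y = t\<close>\<close>

lemma degree_map_poly_const: "Polynomial.degree (map_poly (\<lambda>c. [:c:]) q) = Polynomial.degree q"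
  by (intro degree_map_poly) auto

text \<open>Monicity keeps the sizes of the Sylvester matrices equal under reduction.\<close>

lemma map_poly_sum_resultant:
  fixes f g :: "int poly"
  assumes f: "monic f" and g: "monic g"
  shows "map_poly of_int (sum_resultant f g) =
    resultant (map_poly (\<lambda>c. [:c:]) (map_poly of_int f))
      (pcompose (map_poly (\<lambda>c. [:c:]) (map_poly of_int g)) [:[:0, 1:], -1:] :: 'a :: idom poly poly)"
proof -
  have deg: "Polynomial.degree (map_poly of_int q :: 'a poly) = Polynomial.degree q" if "monic q" for q
    using that by (intro map_poly_degree_eq) auto
  have lift: "map_poly (map_poly of_int) (map_poly (\<lambda>c. [:c:]) q) =
      map_poly (\<lambda>c. [:c:]) (map_poly of_int q :: 'a poly)" for q
    by (intro poly_eqI) (simp add: coeff_map_poly of_int_hom.map_poly_pCons_hom)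
  have lift': "map_poly (map_poly of_int) (pcompose (map_poly (\<lambda>c. [:c:]) g) [:[:0, 1:], -1:]) =
      pcompose (map_poly (\<lambda>c. [:c:]) (map_poly of_int g)) [:[:0, 1:], -1 :: 'a poly:]"
    by (simp add: of_int_poly_hom.map_poly_pcompose lift of_int_poly_hom.hom_uminus)
  show ?thesis unfolding sum_resultant_def
    by (subst of_int_poly_hom.resultant_map_poly[symmetric])
       (simp_all only: lift lift', simp_all add: degree_map_poly_const deg f g)
qed

text \<open>Setting \<open>y = t\<close> commutes with the resultant because no degree in
  \<open>x\<close> drops: the leading coefficients of \<open>F(x)\<close> and
  \<open>G(y - x)\<close> do not involve \<open>y\<close>.\<close>

lemma poly_resultant_sum:
  fixes F G :: "'a :: idom poly"
  shows "poly (resultant (map_poly (\<lambda>c. [:c:]) F) (pcompose (map_poly (\<lambda>c. [:c:]) G) [:[:0, 1:], -1:])) t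
     = resultant F (pcompose G [:t, -1:])" (is ?A)
   and "map_poly (\<lambda>c. poly c t) (map_poly (\<lambda>c. [:c:]) F) = F" (is ?B)
   and "map_poly (\<lambda>c. poly c t) (pcompose (map_poly (\<lambda>c. [:c:]) G) [:[:0, 1:], -1:]) = pcompose G [:t, -1:]" (is ?C)
proof -
  have lift: "map_poly (\<lambda>c. poly c t) (map_poly (\<lambda>c. [:c:]) q) = q" for q :: "'a poly"
    by (intro poly_eqI) (simp add: coeff_map_poly)
  show B: ?B and C: ?C by (simp_all add: poly_hom.map_poly_pcompose lift)
  show ?A
    by (subst poly_hom.resultant_map_poly[symmetric]) (simp_all only: B C, simp_all add: degree_map_poly_const)
qed

lemma root_of_degree_1:
  fixes D :: "'a :: field poly" assumes "Polynomial.degree D = 1"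
  shows "\<exists>r. poly D r = 0"
proof -
  obtain a b where "D = [:a, b:]" "b \<noteq> 0" using degree1_coeffs assms by blast
  then have "poly D (- a / b) = 0" by simp
  then show ?thesis ..
qed

section \<open>Integral minimal polynomials\<close>

lemma monic_if_min_poly_rat:
  fixes f :: "int poly"
  assumes "is_min_poly_rat (map_poly of_int f) \<theta>"
  shows "monic f"
proof -
  have "Polynomial.degree (map_poly of_int f :: rat poly) = Polynomial.degree f"
    by (intro degree_map_poly) auto
  then show ?thesis using assms by (auto simp: is_min_poly_rat_def coeff_map_poly)
qed

text \<open>Since \<open>f\<close> is monic, pseudo-division by \<open>f\<close> is genuine division
  with remainder over the integers. The remainder vanishes at \<theta> and, unless zero, has degree
  below that of \<open>f\<close>, so minimality forces it to be 0.\<close>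

lemma min_poly_dvd_int:
  fixes f h :: "int poly"
  assumes "is_min_poly_rat (map_poly of_int f) \<theta>" and "poly (map_poly of_int h) \<theta> = 0"
  shows "f dvd h"
proof -
  have conv: "map_poly of_rat (map_poly of_int q :: rat poly) = (map_poly of_int q :: complex poly)" for q
    by (intro poly_eqI) (simp add: coeff_map_poly)
  have deg: "Polynomial.degree (map_poly of_int q :: rat poly) = Polynomial.degree q" for q
    by (intro degree_map_poly) auto
  have f: "monic f" by (rule monic_if_min_poly_rat[OF assms(1)])
  have root: "poly (map_poly of_int f) \<theta> = 0"
    using assms(1) by (simp add: is_min_poly_rat_def conv)
  obtain q r where qr: "pseudo_divmod h f = (q, r)" by force
  from f have "f \<noteq> 0" by auto
  from pseudo_divmod[OF this qr] f have h: "h = f * q + r" and r: "r = 0 \<or> Polynomial.degree r < Polynomial.degree f"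
    by auto
  have "poly (map_poly of_int r) \<theta> = 0"
    using assms(2) root unfolding h by (simp add: of_int_poly_hom.hom_add of_int_poly_hom.hom_mult)
  moreover have "Polynomial.degree f \<le> Polynomial.degree r"
    if "poly (map_poly of_int r) \<theta> = 0" "map_poly of_int r \<noteq> (0 :: rat poly)"
    using assms(1) that by (metis conv deg is_min_poly_rat_def)
  ultimately have "map_poly of_int r = (0 :: rat poly)" using r by force
  then have "r = 0" by (auto simp: poly_eq_iff coeff_map_poly)
  with h show ?thesis by simp
qed

section \<open>The ring generated by \<theta> and its first-degree primes\<close>

lemma ring_of_type_algebra_simps:
  "x \<otimes>\<^bsub>ring_of_type_algebra\<^esub> y = x * y" "x \<oplus>\<^bsub>ring_of_type_algebra\<^esub> y = x + y"
  "\<one>\<^bsub>ring_of_type_algebra\<^esub> = 1" "\<zero>\<^bsub>ring_of_type_algebra\<^esub> = 0"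
  "carrier ring_of_type_algebra = UNIV"
  by (simp_all add: ring_of_type_algebra_def)

lemma carrier_int_adjoin:
  "carrier (int_adjoin \<theta>) = range (\<lambda>h. poly (map_poly of_int h) \<theta>)" (is "_ = ?R")
proof -
  note [simp] = ring_of_type_algebra_simps
  interpret C: field complex_ring by (rule field_from_type_algebra)
  have minus: "\<ominus>\<^bsub>complex_ring\<^esub> x = - x" for x
    by (rule C.minus_equality) auto
  have "x \<in> ?R" if "x \<in> generate_ring complex_ring {\<theta>}" for x
    using that
  proof induction
    case one
    show ?case using rangeI[of "\<lambda>h. poly (map_poly of_int h) \<theta>" 1] by simp
  next
    case (incl x)
    then show ?case using rangeI[of "\<lambda>h. poly (map_poly of_int h) \<theta>" "[:0, 1:]"] by simp
  next
    case (a_inv x)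
    then obtain h where "x = poly (map_poly of_int h) \<theta>" by auto
    then have "- x = poly (map_poly of_int (- h)) \<theta>" by (simp add: of_int_poly_hom.hom_uminus)
    then show ?case by (simp only: minus) blast
  next
    case (eng_add x y)
    then obtain h k where "x = poly (map_poly of_int h) \<theta>" "y = poly (map_poly of_int k) \<theta>" by auto
    then have "x + y = poly (map_poly of_int (h + k)) \<theta>" by (simp add: of_int_poly_hom.hom_add)
    then show ?case by (simp del: of_int_poly_hom.hom_add)
  next
    case (eng_mult x y)
    then obtain h k where "x = poly (map_poly of_int h) \<theta>" "y = poly (map_poly of_int k) \<theta>" by auto
    then have "x * y = poly (map_poly of_int (h * k)) \<theta>" by (simp add: of_int_poly_hom.hom_mult)
    then show ?case by (simp del: of_int_poly_hom.hom_mult)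
  qed
  moreover have "poly (map_poly of_int h) \<theta> \<in> generate_ring complex_ring {\<theta>}" for h
  proof -
    have add: "x + y \<in> generate_ring complex_ring {\<theta>}"
      and mult: "x * y \<in> generate_ring complex_ring {\<theta>}"
      and neg: "- x \<in> generate_ring complex_ring {\<theta>}"
      if "x \<in> generate_ring complex_ring {\<theta>}" "y \<in> generate_ring complex_ring {\<theta>}" for x y
      using that generate_ring.eng_add[of _ complex_ring] generate_ring.eng_mult[of _ complex_ring]
        generate_ring.a_inv[of _ complex_ring] minus by fastforce+
    have zero: "0 \<in> generate_ring complex_ring {\<theta>}" using ring.zero_in_generate[OF C.ring_axioms] by simp
    have one: "1 \<in> generate_ring complex_ring {\<theta>}"
      using generate_ring.one[of complex_ring] by simp
    have \<theta>: "\<theta> \<in> generate_ring complex_ring {\<theta>}" by (rule generate_ring.incl) simp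
    have nat: "of_nat n \<in> generate_ring complex_ring {\<theta>}" for n
      by (induction n) (auto intro: add zero one)
    have int: "of_int n \<in> generate_ring complex_ring {\<theta>}" for n
      by (cases n rule: int_cases2) (auto intro: nat neg)
    \<comment> \<open>Horner's scheme: \<open>pCons a h\<close> takes the value
      \<open>a + \<theta> * h(\<theta>)\<close>.\<close>
    show ?thesis
      by (induction h) (auto intro: zero add mult int \<theta>)
  qed
  ultimately show ?thesis by (auto simp: int_adjoin_def)
qed

lemma int_adjoin_simps:
  "x \<otimes>\<^bsub>int_adjoin \<theta>\<^esub> y = x * y" "x \<oplus>\<^bsub>int_adjoin \<theta>\<^esub> y = x + y"
  "\<one>\<^bsub>int_adjoin \<theta>\<^esub> = 1" "\<zero>\<^bsub>int_adjoin \<theta>\<^esub> = 0"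
  by (simp_all add: int_adjoin_def ring_of_type_algebra_def)

lemma cring_int_adjoin: "cring (int_adjoin \<theta>)"
proof -
  interpret C: field complex_ring by (rule field_from_type_algebra)
  have "subring (generate_ring complex_ring {\<theta>}) complex_ring"
    by (rule C.generate_ring_is_subring) (simp add: ring_of_type_algebra_simps)
  then show ?thesis unfolding int_adjoin_def
    using C.subcring_iff C.subcringI' C.generate_ring_incl[of "{\<theta>}"]
    by (simp add: ring_of_type_algebra_simps)
qed

text \<open>The kernel is the preimage of the zero ideal of a field, hence prime. It contains the
  nonzero number p, and the quotient has p elements by the first isomorphism theorem, since \<phi>
  is onto.\<close>

lemma first_degree_prime_pair_if_ring_hom:
  fixes \<phi> :: "complex \<Rightarrow> 'p :: prime_card mod_ring"
  assumes hom: "\<phi> \<in> Ring.ring_hom (int_adjoin \<theta>) prime_field_ring"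
  shows "first_degree_prime_pair \<theta> (\<phi> \<theta>)"
proof -
  let ?R = "int_adjoin \<theta>" and ?S = "prime_field_ring :: 'p mod_ring ring"
  define P where "P = a_kernel ?R ?S \<phi>"
  have R: "cring ?R" by (rule cring_int_adjoin)
  have S: "field ?S" by (rule field_from_type_algebra)
  have hom_ring: "ring_hom_ring ?R ?S \<phi>"
    using ring_hom_ringI2[OF _ _ hom] R S by (simp add: cring.axioms(1) field.is_ring)
  have P: "P = {x \<in> carrier ?R. \<phi> x = 0}"
    by (simp add: P_def a_kernel_def' ring_of_type_algebra_simps)
  have nat_carrier: "of_nat n \<in> carrier ?R" for n
    by (auto simp: carrier_int_adjoin of_int_hom.map_poly_pCons_hom intro!: image_eqI[of _ _ "[:int n:]"])
  \<comment> \<open>This puts p into the kernel and also gives surjectivity, as every element of the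
    prime field is a multiple of 1.\<close>
  have \<phi>_nat: "\<phi> (of_nat n) = of_nat n" for n
  proof (induction n)
    case 0
    show ?case using ring_hom_zero[OF hom] R S
      by (simp add: cring.axioms(1) field.is_ring int_adjoin_simps ring_of_type_algebra_simps)
  next
    case (Suc n)
    then show ?case
      using ring_hom_add[OF hom nat_carrier[of 1] nat_carrier[of n]] ring_hom_one[OF hom]
      by (simp add: int_adjoin_simps ring_of_type_algebra_simps)
  qed
  have "pair_ideal \<theta> (\<phi> \<theta>) P" using hom by (auto simp: pair_ideal_def P_def)
  moreover have "primeideal P ?R"
    using ring_hom_ring.primeideal_vimage[OF hom_ring R domain.zeroprimeideal[OF field.axioms(1)[OF S]]]
    by (simp add: P ring_of_type_algebra_simps)
  moreover have "P \<noteq> {0}"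
  proof -
    have "of_nat CARD('p) \<in> P"
      using nat_carrier \<phi>_nat by (simp add: P)
    moreover have "of_nat CARD('p) \<noteq> (0 :: complex)" by simp
    ultimately show ?thesis by blast
  qed
  moreover have "card (carrier (?R Quot P)) = CARD('p)"
  proof -
    have "x \<in> \<phi> ` carrier ?R" for x
      using surj_of_nat_mod_ring[of x] nat_carrier \<phi>_nat by (metis image_eqI)
    then have "\<phi> ` carrier ?R = carrier ?S" by (auto simp: ring_of_type_algebra_simps)
    from ring_hom_ring.FactRing_iso_set[OF hom_ring this]
    have "bij_betw (\<lambda>Y. the_elem (\<phi> ` Y)) (carrier (?R Quot P)) UNIV"
      by (simp add: ring_iso_def P_def ring_of_type_algebra_simps)
    then show ?thesis by (simp add: bij_betw_same_card)
  qed
  ultimately show ?thesis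
    using prime_card[where 'a = 'p] by (auto simp: first_degree_prime_pair_def first_degree_prime_def)
qed

text \<open>The assignment \<open>h(\<theta>) \<mapsto> h(r)\<close> is well defined: polynomials
  that agree at \<theta> differ by a multiple of \<open>f\<close>, which vanishes at
  \<open>r\<close> modulo p.\<close>

lemma first_degree_prime_pair_if_root:
  fixes r :: "'p :: prime_card mod_ring"
  assumes f: "is_min_poly_rat (map_poly of_int f) \<theta>"
    and root: "poly (map_poly of_int f) r = 0"
  shows "first_degree_prime_pair \<theta> r"
proof -
  let ?R = "int_adjoin \<theta>" and ?S = "prime_field_ring :: 'p mod_ring ring"
  let ?ev = "\<lambda>h. poly (map_poly of_int h) \<theta>"
  have wd: "poly (map_poly of_int h) r = poly (map_poly of_int k) r" if "?ev h = ?ev k" for h k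
  proof -
    have "?ev (h - k) = 0" using that by (simp add: of_int_poly_hom.hom_minus)
    then have "f dvd h - k" by (rule min_poly_dvd_int[OF f])
    then obtain q where "h - k = f * q" by (elim dvdE)
    then have "poly (map_poly of_int (h - k)) r = 0"
      using root by (simp add: of_int_poly_hom.hom_mult)
    then show ?thesis by (simp add: of_int_poly_hom.hom_minus)
  qed
  \<comment> \<open>An arbitrary polynomial representing \<open>x\<close> is picked; by
    \<open>wd\<close> the choice does not affect the value.\<close>
  define \<phi> where "\<phi> x = poly (map_poly of_int (SOME h. x = ?ev h)) r" for x
  have \<phi>: "\<phi> (?ev h) = poly (map_poly of_int h) r" for h
  proof -
    have "?ev h = ?ev (SOME k. ?ev h = ?ev k)" by (rule someI) (rule refl)
    from wd[OF this] show ?thesis by (simp only: \<phi>_def)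
  qed
  have "\<phi> \<in> Ring.ring_hom ?R ?S"
  proof (rule ring_hom_memI)
    fix x y assume "x \<in> carrier ?R" "y \<in> carrier ?R"
    then obtain h k where xy: "x = ?ev h" "y = ?ev k" by (auto simp: carrier_int_adjoin)
    show "\<phi> (x \<otimes>\<^bsub>?R\<^esub> y) = \<phi> x \<otimes>\<^bsub>?S\<^esub> \<phi> y" "\<phi> (x \<oplus>\<^bsub>?R\<^esub> y) = \<phi> x \<oplus>\<^bsub>?S\<^esub> \<phi> y"
      using \<phi>[of "h * k"] \<phi>[of "h + k"]
      by (simp_all add: xy \<phi> of_int_poly_hom.hom_add of_int_poly_hom.hom_mult
          int_adjoin_simps ring_of_type_algebra_simps)
  next
    show "\<phi> \<one>\<^bsub>?R\<^esub> = \<one>\<^bsub>?S\<^esub>"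
      using \<phi>[of 1] by (simp add: int_adjoin_simps ring_of_type_algebra_simps)
  qed (simp add: ring_of_type_algebra_simps)
  moreover have "\<phi> \<theta> = r" using \<phi>[of "[:0, 1:]"] by simp
  ultimately show ?thesis using first_degree_prime_pair_if_ring_hom by blast
qed

section \<open>Splitting a simple root of the resultant\<close>

lemma roots_if_simple_root_resultant:
  fixes F G :: "'a :: field_gcd poly"
  assumes "F \<noteq> 0"
    and simple: "is_simple_root (resultant (map_poly (\<lambda>c. [:c:]) F)
        (pcompose (map_poly (\<lambda>c. [:c:]) G) [:[:0, 1:], -1:])) t"
  shows "\<exists>r s. poly F r = 0 \<and> poly G s = 0 \<and> t = r + s"
proof -
  let ?R = "resultant (map_poly (\<lambda>c. [:c:]) F) (pcompose (map_poly (\<lambda>c. [:c:]) G) [:[:0, 1:], -1:])"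
  define H where "H = pcompose G [:t, -1:]"
  define D where "D = gcd F H"
  have R: "?R \<noteq> 0" "Polynomial.order t ?R = 1"
    using simple by (auto simp: is_simple_root_def)
  then have "poly ?R t = 0" by (metis order_root zero_neq_one)
  then have "Polynomial.degree D \<noteq> 0"
    unfolding poly_resultant_sum D_def H_def by (simp add: resultant_0_gcd)
  moreover have "[:-t, 1:] ^ Polynomial.degree D dvd ?R"
  proof (rule resultant_dvd_if_common_factor)
    have "Polynomial.degree D \<le> Polynomial.degree F"
      using \<open>F \<noteq> 0\<close> by (simp add: D_def dvd_imp_degree_le)
    also have "Polynomial.degree F = Polynomial.degree (map_poly (\<lambda>c. [:c:]) F)"
      by (rule degree_map_poly_const[symmetric])
    finally show "Polynomial.degree D \<le> Polynomial.degree (map_poly (\<lambda>c. [:c:]) F) +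
        Polynomial.degree (pcompose (map_poly (\<lambda>c. [:c:]) G) [:[:0, 1:], -1:])" by simp
  qed (unfold poly_resultant_sum D_def H_def, auto)
  \<comment> \<open>The exponent \<open>degree D\<close> is at most the order of \<open>t\<close> as
    a root of the nonzero resultant, which is 1.\<close>
  then have "Polynomial.degree D \<le> 1"
    using R unfolding order_divides by (simp only: simp_thms)
  ultimately obtain r where r: "poly D r = 0"
    using root_of_degree_1[of D] by (auto simp: le_Suc_eq)
  have "poly F r = 0" "poly H r = 0"
    using r poly_eq_0_iff_dvd dvd_trans unfolding D_def by (metis gcd_dvd1, metis gcd_dvd2)
  moreover from this have "poly G (t - r) = 0" by (simp add: H_def poly_pcompose)
  ultimately show ?thesis by (metis add.commute diff_add_cancel)
qed

theorem proposition3p6: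
  fixes \<alpha> \<beta> :: complex
    and f g :: "int poly"
    and t :: "'p :: prime_card mod_ring"
  assumes "algebraic_int \<alpha>" and "algebraic_int \<beta>"
    and "linearly_disjoint (rat_adjoin \<alpha>) (rat_adjoin \<beta>)"
    and "is_min_poly_rat (map_poly of_int f) \<alpha>"
    and "is_min_poly_rat (map_poly of_int g) \<beta>"
    and "first_degree_prime_pair (\<alpha> + \<beta>) t"
    and "is_simple_root (map_poly of_int (sum_resultant f g)) t"
  shows "\<exists>r s :: 'p mod_ring.
           first_degree_prime_pair \<alpha> r \<and> first_degree_prime_pair \<beta> s \<and> t = r + s"
proof -
  note f = monic_if_min_poly_rat[OF assms(4)] and g = monic_if_min_poly_rat[OF assms(5)]
  \<comment> \<open>The leading coefficient 1 survives reduction modulo p, so the reduced polynomial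
    is not zero.\<close>
  have "Polynomial.coeff (map_poly of_int f :: 'p mod_ring poly) (Polynomial.degree f) = 1"
    using f by (simp add: coeff_map_poly)
  then have "map_poly of_int f \<noteq> (0 :: 'p mod_ring poly)" by force
  from roots_if_simple_root_resultant[OF this assms(7)[unfolded map_poly_sum_resultant[OF f g]]]
  show ?thesis using first_degree_prime_pair_if_root assms(4,5) by blast
qed

end
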